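(* Let $X_0=0$ and $X_n=\sum_{j=1}^{X_{n-1}}\xi_{n,j}+\varepsilon_n$ for $n\ge1$, where $\{\xi_{n,j},\varepsilon_n\}$ are independent nonnegative integer-valued random variables with $\xi_{n,j}$, $j\in\mathbb N$, identically distributed for each $n$. Let $G_n(x)=\mathbb E x^{\xi_{n,1}}$, $H_n(x)=\mathbb E x^{\varepsilon_n}$, $\rho_n=G_n'(1)$, $G_n''(1)<\infty$, and $m_{n,k}=H_n^{(k)}(1)$ (the $k$-th factorial moment of $\varepsilon_n$, assumed finite for all $k$). Assume (i) $\rho_n<1$, $\lim_n\rho_n=1$, $\sum_{n=1}^\infty(1-\rho_n)=\infty$, and $\lim_n G_n''(1)/(1-\rho_n)=0$; (ii) $\lim_{n\to\infty}\frac{m_{n,j}}{j(1-\rho_n)}=\lambda_j$ exists (finite) for every $j=1,2,\dots$, and $\limsup_{n\to\infty}(\lambda_n/n!)^{1/n}\le 1$. Then $X_n$ converges in distribution to a random variable $Y$ with generating function $$\mathbb E x^Y=\exp\Big\{\sum_{l=1}^\infty\frac{(x-1)^l}{l!}\lambda_l\Big\},\qquad x\in(0,1).$$ *)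

theory Defs
  imports "HOL-Probability.Probability"
begin

primrec bpi :: "(nat \<Rightarrow> nat \<Rightarrow> 'a \<Rightarrow> nat) \<Rightarrow> (nat \<Rightarrow> 'a \<Rightarrow> nat) \<Rightarrow> nat \<Rightarrow> 'a \<Rightarrow> nat" where
  "bpi xi eps 0 \<omega> = 0"
| "bpi xi eps (Suc n) \<omega> = (\<Sum>j = 1..bpi xi eps n \<omega>. xi (Suc n) j \<omega>) + eps (Suc n) \<omega>"

definition falling_fact :: "nat \<Rightarrow> nat \<Rightarrow> real" where
  "falling_fact k z = (\<Prod>i<k. real z - real i)"

(* k-th factorial moment E[Z(Z-1)...(Z-k+1)] = k-th derivative at 1 of the pgf E x^Z *)
definition fact_moment :: "'a measure \<Rightarrow> ('a \<Rightarrow> nat) \<Rightarrow> nat \<Rightarrow> real" where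
  "fact_moment M Z k = (\<integral>\<omega>. falling_fact k (Z \<omega>) \<partial>M)"

end

theory Submission
  imports Defs
begin

text \<open>
  Substitute $x = 1 + y$ with $y \in [-r, 0]$, $r < 1$, and put $a_n = 1 - \rho_n$,
  $\phi_n(y) = E (1+y)^{X_n}$, $h_n(y) = H_n(1+y)$, $g_n(y) = G_n(1+y) - 1$, so that
  $\phi_n = h_n \cdot (\phi_{n-1} \circ g_n)$. The limit $\Phi(y) = \exp \sum_l \lambda_l y^l / l!$
  is an approximate fixed point of this recursion: Bonferroni's inequalities give
  $h_n(y) = 1 + a_n y Q(y) + o(a_n) |y|$ and $g_n(y) = (1 - a_n) y + o(a_n) y^2$ uniformly in $y$,
  while $\Phi' = Q \Phi$, so that $|h_n \cdot (\Phi \circ g_n) - \Phi| \le o(a_n) |y|$.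
  As $|g_n(y)| \le (1 - a_n) |y|$ and $0 \le h_n \le 1$, the quantity
  $e_n = \sup_y |\phi_n(y) - \Phi(y)| / |y|$ satisfies $e_n \le (1 - a_n) e_{n-1} + o(a_n)$,
  and divergence of $\sum a_n$ forces $e_n \to 0$.
\<close>

text \<open>Dividing the error by |y| is what produces a contraction: with only h_n <= 1 at hand,
  the plain supremum of |phi_n - Phi| need not shrink in one step, whereas |g_n(y)| <= (1 - a_n) |y|
  shrinks the weighted one. The price is that every one-step error must be small compared with a_n
  |y|, not merely with a_n. The weight does no harm at y = 0, because phi_n and Phi both equal 1
  there and differ by O(|y|) nearby. The divisor j in the hypothesis on m_{n,j} makes m_{n,j} / (j!
  a_n) tend to lambda_j / (j-1)!, the coefficient of y^(j-1) in Q, which is the derivative of the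
  exponent of Phi. The restriction r < 1 keeps [-r, 0] inside the region where the series of Q
  converges absolutely, hence the uniform bounds. Convergence in distribution is then read off from
  the coefficients of the generating functions, and Phi(0) = 1 excludes escape of mass to
  infinity.\<close>

section \<open>Power series and the error of one step of the recursion\<close>

lemma conv_radius_diffs_ge:
  fixes c :: "nat \<Rightarrow> real"
  shows "conv_radius c \<le> conv_radius (diffs c)"
proof (rule conv_radius_geI_ex')
  fix r :: real assume r: "0 < r" "ereal r < conv_radius c"
  obtain K where K: "r < K" "ereal K < conv_radius c"
    using ereal_dense2[OF r(2)] by auto
  show "summable (\<lambda>n. diffs c n * of_real r ^ n)"
  proof (rule termdiff_converges[of _ K])
    fix x :: real assume "norm x < K"
    hence "ereal (norm x) < conv_radius c" using K(2) by (meson ereal_less_eq(3) le_less_trans less_imp_le)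
    thus "summable (\<lambda>n. c n * x ^ n)" by (rule summable_in_conv_radius)
  qed (use r K in auto)
qed

text \<open>The coefficients converge one by one, with no uniformity in \<open>j\<close>, so the
  expansion is cut at a fixed \<open>K\<close>. Three errors remain after division by
  \<open>a n * \<bar>y\<bar>\<close>: finitely many coefficient differences, the remainder of
  \<open>h\<close>, and the tail of the limit series. The remainder is controlled by the single next
  coefficient, so it too has a limit as \<open>n\<close> grows.\<close>

lemma pgf_coefficient_expansion:
  fixes a :: "nat \<Rightarrow> real" and b :: "nat \<Rightarrow> nat \<Rightarrow> real" and c :: "nat \<Rightarrow> real"
    and h :: "nat \<Rightarrow> real \<Rightarrow> real"
  assumes r: "0 \<le> r" "r < 1" and e: "e > 0"
    and a_pos: "\<And>n. 0 < a n"
    and conv: "conv_radius c \<ge> 1"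
    and b_lim: "\<And>j. (\<lambda>n. b n (Suc j) / a n) \<longlonglongrightarrow> diffs c j"
    and h_exp: "\<And>n y K. y \<in> {-1..0} \<Longrightarrow>
        \<bar>h n y - 1 - (\<Sum>j<K. b n (Suc j) * y ^ Suc j)\<bar> \<le> b n (Suc K) * \<bar>y\<bar> ^ Suc K"
  shows "\<forall>\<^sub>F n in sequentially. \<forall>y\<in>{-r..0}. 
           \<bar>h n y - 1 - a n * y * (\<Sum>j. diffs c j * y ^ j)\<bar> \<le> e * a n * \<bar>y\<bar>"
proof -
  define d where "d = diffs c"
  have sm: "summable (\<lambda>j. norm (d j * z ^ j))" if "\<bar>z\<bar> \<le> r" for z :: real
  proof (rule abs_summable_in_conv_radius)
    have "ereal (norm z) < 1" using that r by simp
    also have "1 \<le> conv_radius d" unfolding d_def using conv conv_radius_diffs_ge[of c] by (rule order_trans)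
    finally show "ereal (norm z) < conv_radius d" .
  qed
  have smr: "summable (\<lambda>j. \<bar>d j\<bar> * r ^ j)"
    using sm[of r] r by (simp add: abs_mult)
  have "(\<lambda>K. \<Sum>j. \<bar>d (j + K)\<bar> * r ^ (j + K)) \<longlonglongrightarrow> 0"
    by (rule suminf_exist_split2[OF smr])
  moreover have "(\<lambda>K. \<bar>d K\<bar> * r ^ K) \<longlonglongrightarrow> 0"
    using smr by (rule summable_LIMSEQ_zero)
  ultimately have "(\<lambda>K. (\<Sum>j. \<bar>d (j + K)\<bar> * r ^ (j + K)) + \<bar>d K\<bar> * r ^ K) \<longlonglongrightarrow> 0 + 0"
    by (intro tendsto_add)
  hence "\<forall>\<^sub>F K in sequentially. (\<Sum>j. \<bar>d (j + K)\<bar> * r ^ (j + K)) + \<bar>d K\<bar> * r ^ K < e"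
    using e by (intro order_tendstoD(2)) auto
  \<comment> \<open>Besides the tail, the term of index \<open>K\<close> must be small: it is the
    limit of the bound on the remainder of \<open>h\<close>.\<close>
  then obtain K where K: "(\<Sum>j. \<bar>d (j + K)\<bar> * r ^ (j + K)) + \<bar>d K\<bar> * r ^ K < e"
    by (auto simp: eventually_sequentially)
  define T where "T = (\<Sum>j. \<bar>d (j + K)\<bar> * r ^ (j + K))"
  have "(\<lambda>n. (\<Sum>j<K. \<bar>b n (Suc j) / a n - d j\<bar>) + \<bar>b n (Suc K) / a n\<bar> * r ^ K + T)
      \<longlonglongrightarrow> (\<Sum>j<K. \<bar>d j - d j\<bar>) + \<bar>d K\<bar> * r ^ K + T"
    unfolding d_def by (intro tendsto_intros b_lim)
  hence "\<forall>\<^sub>F n in sequentially.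
      (\<Sum>j<K. \<bar>b n (Suc j) / a n - d j\<bar>) + \<bar>b n (Suc K) / a n\<bar> * r ^ K + T < e"
    by (rule order_tendstoD(2)) (use K in \<open>simp add: T_def\<close>)
  thus ?thesis
  proof eventually_elim
    case (elim n)
    show ?case
    proof
      fix y assume y: "y \<in> {-r..0}"
      hence yr: "\<bar>y\<bar> \<le> r" and y1: "y \<in> {-1..0}" using r by auto
      have a: "a n > 0" by (rule a_pos)
      have pw: "\<bar>y\<bar> ^ j \<le> r ^ j" for j using yr by (intro power_mono) auto
      have smy: "summable (\<lambda>j. d j * y ^ j)" using sm[OF yr] by (rule summable_norm_cancel)
      have split: "(\<Sum>j. d j * y ^ j) = (\<Sum>j. d (j + K) * y ^ (j + K)) + (\<Sum>j<K. d j * y ^ j)"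
        by (rule suminf_split_initial_segment[OF smy])
      have smK: "summable (\<lambda>j. \<bar>d (j + K) * y ^ (j + K)\<bar>)"
        using summable_ignore_initial_segment[OF sm[OF yr], of K] by simp
      have "\<bar>\<Sum>j. d (j + K) * y ^ (j + K)\<bar> \<le> (\<Sum>j. \<bar>d (j + K) * y ^ (j + K)\<bar>)"
        by (rule summable_rabs[OF smK])
      also have "\<dots> \<le> T" unfolding T_def
        by (intro suminf_le smK summable_ignore_initial_segment[OF smr])
           (auto simp: abs_mult power_abs intro!: mult_left_mono pw)
      finally have tail: "\<bar>\<Sum>j. d (j + K) * y ^ (j + K)\<bar> \<le> T" .
      define U where "U = (\<Sum>j<K. (b n (Suc j) / a n - d j) * y ^ j)"
      have "\<bar>U\<bar> \<le> (\<Sum>j<K. \<bar>(b n (Suc j) / a n - d j) * y ^ j\<bar>)"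
        unfolding U_def by (rule sum_abs)
      also have "\<dots> \<le> (\<Sum>j<K. \<bar>b n (Suc j) / a n - d j\<bar>)"
        using y1 by (intro sum_mono) (auto simp: abs_mult power_abs intro!: mult_left_le power_le_one)
      finally have U: "\<bar>U\<bar> \<le> (\<Sum>j<K. \<bar>b n (Suc j) / a n - d j\<bar>)" .
      have eqU: "(\<Sum>j<K. b n (Suc j) * y ^ Suc j) = a n * y * (U + (\<Sum>j<K. d j * y ^ j))"
        using a by (simp add: U_def sum.distrib[symmetric] sum_distrib_left algebra_simps diff_divide_distrib)
      define R where "R = h n y - 1 - (\<Sum>j<K. b n (Suc j) * y ^ Suc j)"
      have "\<bar>R\<bar> \<le> b n (Suc K) * \<bar>y\<bar> ^ Suc K"
        unfolding R_def by (rule h_exp[OF y1])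
      also have "\<dots> \<le> \<bar>b n (Suc K)\<bar> * \<bar>y\<bar> ^ Suc K"
        by (intro mult_right_mono) auto
      also have "\<dots> = a n * \<bar>y\<bar> * (\<bar>b n (Suc K) / a n\<bar> * \<bar>y\<bar> ^ K)"
        using a by (simp add: field_simps)
      also have "\<dots> \<le> a n * \<bar>y\<bar> * (\<bar>b n (Suc K) / a n\<bar> * r ^ K)"
        using a by (intro mult_left_mono pw) auto
      finally have R: "\<bar>R\<bar> \<le> a n * \<bar>y\<bar> * (\<bar>b n (Suc K) / a n\<bar> * r ^ K)" .
      have "h n y - 1 - a n * y * (\<Sum>j. d j * y ^ j)
          = R + a n * y * (U - (\<Sum>j. d (j + K) * y ^ (j + K)))"
        unfolding split R_def eqU by (simp add: algebra_simps)
      also have "\<bar>\<dots>\<bar> \<le> \<bar>R\<bar> + a n * \<bar>y\<bar> * \<bar>U - (\<Sum>j. d (j + K) * y ^ (j + K))\<bar>"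
        using a abs_triangle_ineq[of R "a n * y * (U - (\<Sum>j. d (j + K) * y ^ (j + K)))"] by (simp add: abs_mult)
      also have "\<dots> \<le> a n * \<bar>y\<bar> * (\<bar>b n (Suc K) / a n\<bar> * r ^ K)
                    + a n * \<bar>y\<bar> * ((\<Sum>j<K. \<bar>b n (Suc j) / a n - d j\<bar>) + T)"
        using a R U tail by (intro add_mono mult_left_mono) auto
      also have "\<dots> = a n * \<bar>y\<bar> * ((\<Sum>j<K. \<bar>b n (Suc j) / a n - d j\<bar>) + \<bar>b n (Suc K) / a n\<bar> * r ^ K + T)"
        by (simp add: algebra_simps)
      also have "\<dots> \<le> a n * \<bar>y\<bar> * e"
        using a elim by (intro mult_left_mono) auto
      finally show "\<bar>h n y - 1 - a n * y * (\<Sum>j. diffs c j * y ^ j)\<bar> \<le> e * a n * \<bar>y\<bar>"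
        by (simp add: d_def mult_ac)
    qed
  qed
qed

lemma exp_power_series_derivative:
  fixes c :: "nat \<Rightarrow> real"
  assumes "conv_radius c \<ge> 1" "\<bar>y\<bar> < 1"
  shows "((\<lambda>y. exp (\<Sum>l. c l * y ^ l)) has_real_derivative
            (\<Sum>l. diffs c l * y ^ l) * exp (\<Sum>l. c l * y ^ l)) (at y)"
    and "isCont (\<lambda>y. \<Sum>l. diffs c l * y ^ l) y"
proof -
  have sm: "summable (\<lambda>n. f n * z ^ n)" if "norm z < 1" "conv_radius f \<ge> 1" for f :: "nat \<Rightarrow> real" and z
  proof (rule summable_in_conv_radius)
    have "ereal (norm z) < 1" using that by simp
    thus "ereal (norm z) < conv_radius f" using that(2) by (rule less_le_trans)
  qed
  have d: "conv_radius (diffs c) \<ge> 1"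
    using assms(1) conv_radius_diffs_ge[of c] by (rule order_trans)
  have "((\<lambda>y. \<Sum>l. c l * y ^ l) has_real_derivative (\<Sum>l. diffs c l * y ^ l)) (at y)"
    using assms by (intro termdiffs_strong'[where K = 1] sm) auto
  thus "((\<lambda>y. exp (\<Sum>l. c l * y ^ l)) has_real_derivative
            (\<Sum>l. diffs c l * y ^ l) * exp (\<Sum>l. c l * y ^ l)) (at y)"
    by (auto intro!: derivative_eq_intros)
  have "((\<lambda>y. \<Sum>l. diffs c l * y ^ l) has_real_derivative (\<Sum>l. diffs (diffs c) l * y ^ l)) (at y)"
    using assms(2) d by (intro termdiffs_strong'[where K = 1] sm) auto
  thus "isCont (\<lambda>y. \<Sum>l. diffs c l * y ^ l) y" by (rule DERIV_isCont)
qed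

text \<open>To first order in \<open>a n\<close>, the factor \<open>h\<close> adds
  \<open>a n * y * Q y * \<Phi> y\<close>, while moving the argument from \<open>y\<close> to about
  \<open>(1 - a n) * y\<close> subtracts \<open>a n * y\<close> times the derivative of
  \<open>\<Phi>\<close>. The differential equation makes these two terms cancel, leaving errors of
  smaller order.\<close>

lemma near_fixed_point_estimate:
  fixes a b :: "nat \<Rightarrow> real" and \<Phi> Q :: "real \<Rightarrow> real" and g h :: "nat \<Rightarrow> real \<Rightarrow> real"
  assumes r: "0 \<le> r" "r < 1" and e: "e > 0"
    and deriv: "\<And>y. y \<in> {-r..0} \<Longrightarrow> (\<Phi> has_real_derivative Q y * \<Phi> y) (at y)"
    and contQ: "continuous_on {-r..0} Q"
    and a_pos: "\<And>n. 0 < a n" and a_lim: "a \<longlonglongrightarrow> 0"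
    and b_lim: "(\<lambda>n. b n / a n) \<longlonglongrightarrow> 0"
    and g_range: "\<And>n y. y \<in> {-r..0} \<Longrightarrow> g n y \<in> {-r..0}"
    and g_exp: "\<And>n y. y \<in> {-r..0} \<Longrightarrow> \<bar>g n y - (1 - a n) * y\<bar> \<le> b n * y\<^sup>2"
    and h_exp: "\<And>e. e > 0 \<Longrightarrow> \<forall>\<^sub>F n in sequentially. \<forall>y\<in>{-r..0}.
                  \<bar>h n y - 1 - a n * y * Q y\<bar> \<le> e * a n * \<bar>y\<bar>"
  shows "\<forall>\<^sub>F n in sequentially. \<forall>y\<in>{-r..0}. \<bar>h n y * \<Phi> (g n y) - \<Phi> y\<bar> \<le> e * a n * \<bar>y\<bar>"
proof -
  define \<Phi>' where "\<Phi>' y = Q y * \<Phi> y" for y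
  have cont: "continuous_on {-r..0} \<Phi>"
    using deriv by (meson DERIV_isCont continuous_at_imp_continuous_on)
  have cont': "continuous_on {-r..0} \<Phi>'"
    unfolding \<Phi>'_def by (intro continuous_intros cont contQ)
  have bnd: "\<exists>B\<ge>0. \<forall>y\<in>{-r..0}. \<bar>f y\<bar> \<le> B" if "continuous_on {-r..0} f" for f :: "real \<Rightarrow> real"
  proof -
    have "bounded (f ` {-r..0})"
      by (intro compact_imp_bounded compact_continuous_image that) auto
    then obtain B where "B > 0" "\<And>x. x \<in> f ` {-r..0} \<Longrightarrow> norm x \<le> B"
      unfolding bounded_pos by blast
    thus ?thesis by (intro exI[of _ B]) auto
  qed
  from bnd[OF cont] bnd[OF cont'] bnd[OF contQ] obtain B1 B2 B3 where
    "B1 \<ge> 0" "B2 \<ge> 0" "B3 \<ge> 0" "\<And>y. y\<in>{-r..0} \<Longrightarrow> \<bar>\<Phi> y\<bar> \<le> B1"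
    "\<And>y. y\<in>{-r..0} \<Longrightarrow> \<bar>\<Phi>' y\<bar> \<le> B2" "\<And>y. y\<in>{-r..0} \<Longrightarrow> \<bar>Q y\<bar> \<le> B3" by metis
  then obtain B where B: "B \<ge> 0" and B1: "\<And>y. y\<in>{-r..0} \<Longrightarrow> \<bar>\<Phi> y\<bar> \<le> B"
    and B2: "\<And>y. y\<in>{-r..0} \<Longrightarrow> \<bar>\<Phi>' y\<bar> \<le> B" and B3: "\<And>y. y\<in>{-r..0} \<Longrightarrow> \<bar>Q y\<bar> \<le> B"
    by (intro that[of "max B1 (max B2 B3)"]) (force simp: le_max_iff_disj)+
  \<comment> \<open>The four error terms below add up to \<open>e' * (2 * B + 1 + B\<^sup>2)\<close>
    times \<open>a n * \<bar>y\<bar>\<close>, which this choice turns into exactly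
    \<open>e\<close>.\<close>
  define e' where "e' = e / (B + 1)\<^sup>2"
  have e': "e' > 0" using e B by (simp add: e'_def)
  have "uniformly_continuous_on {-r..0} \<Phi>'"
    using cont' by (intro compact_uniformly_continuous) auto
  then obtain d where d: "d > 0" 
    "\<And>y z. y\<in>{-r..0} \<Longrightarrow> z\<in>{-r..0} \<Longrightarrow> \<bar>z - y\<bar> < d \<Longrightarrow> \<bar>\<Phi>' z - \<Phi>' y\<bar> < e'"
    using e' unfolding uniformly_continuous_on_def dist_real_def by metis
  \<comment> \<open>The bound 1 yields \<open>\<bar>g n y - y\<bar> \<le> 2 * a n\<close>. The bound
    on \<open>a n\<close> in the next line then serves twice: the mean value point stays within
    \<open>d\<close> of \<open>y\<close>, and \<open>\<Phi>\<close> changes by at most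
    \<open>e' * B\<close>.\<close>
  have "\<forall>\<^sub>F n in sequentially. b n / a n < min e' 1" using e' by (intro order_tendstoD(2)[OF b_lim]) auto
  moreover have "\<forall>\<^sub>F n in sequentially. a n < min d e' / 2" using e' d by (intro order_tendstoD(2)[OF a_lim]) auto
  ultimately show ?thesis using h_exp[OF e']
  proof eventually_elim
    case (elim n)
    have a: "a n > 0" by (rule a_pos)
    have b: "b n \<le> e' * a n" "b n \<le> a n" using elim(1) a by (auto simp: field_simps)
    show ?case
    proof
      fix y assume y: "y \<in> {-r..0}"
      define z where "z = g n y"
      have z: "z \<in> {-r..0}" unfolding z_def by (rule g_range[OF y])
      have y1: "\<bar>y\<bar> \<le> 1" using y r by auto
      have y2: "y\<^sup>2 \<le> \<bar>y\<bar>" using y1 mult_right_mono[of "\<bar>y\<bar>" 1 "\<bar>y\<bar>"] by (simp add: power2_eq_square)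
      have zexp: "\<bar>z - y + a n * y\<bar> \<le> b n * y\<^sup>2"
        using g_exp[OF y, of n] by (simp add: z_def algebra_simps)
      have le: "b n * y\<^sup>2 \<le> (e' * a n) * \<bar>y\<bar>" "b n * y\<^sup>2 \<le> a n * \<bar>y\<bar>"
        using b y2 a e' by (auto intro!: mult_mono)
      have "\<bar>z - y\<bar> \<le> \<bar>z - y + a n * y\<bar> + \<bar>a n * y\<bar>" by linarith
      also have "\<dots> \<le> a n * \<bar>y\<bar> + a n * \<bar>y\<bar>" using order_trans[OF zexp le(2)] a by (simp add: abs_mult mult.commute)
      also have "\<dots> \<le> 2 * a n" using mult_left_mono[OF y1, of "a n"] a by simp
      finally have zy: "\<bar>z - y\<bar> \<le> 2 * a n" .
      have "\<exists>\<theta>\<in>{-r..0}. \<bar>\<theta> - y\<bar> \<le> \<bar>z - y\<bar> \<and> \<Phi> z - \<Phi> y = (z - y) * \<Phi>' \<theta>"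
      proof -
        have *: "\<exists>\<theta>. u < \<theta> \<and> \<theta> < v \<and> \<Phi> v - \<Phi> u = (v - u) * \<Phi>' \<theta>"
          if "u < v" "u \<in> {-r..0}" "v \<in> {-r..0}" for u v
          using that deriv by (intro MVT2) (auto simp: \<Phi>'_def)
        consider "y = z" | "y < z" | "z < y" by linarith
        thus ?thesis
        proof cases
          case 1 thus ?thesis using y by auto
        next
          case 2
          with *[OF 2 y z] obtain \<theta> where "y < \<theta>" "\<theta> < z" "\<Phi> z - \<Phi> y = (z - y) * \<Phi>' \<theta>" by auto
          thus ?thesis using y z by (intro bexI[of _ \<theta>]) auto
        next
          case 3
          with *[OF 3 z y] obtain \<theta> where "z < \<theta>" "\<theta> < y" "\<Phi> y - \<Phi> z = (y - z) * \<Phi>' \<theta>" by auto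
          thus ?thesis using y z by (intro bexI[of _ \<theta>]) (auto simp: algebra_simps)
        qed
      qed
      then obtain \<theta> where \<theta>: "\<theta> \<in> {-r..0}" "\<bar>\<theta> - y\<bar> \<le> \<bar>z - y\<bar>" "\<Phi> z - \<Phi> y = (z - y) * \<Phi>' \<theta>" by auto
      have "\<bar>\<theta> - y\<bar> < d" using \<theta>(2) zy elim(2) by linarith
      hence \<Phi>'_close: "\<bar>\<Phi>' \<theta> - \<Phi>' y\<bar> \<le> e'" using d(2)[OF y \<theta>(1)] by simp
      define t where "t = a n * \<bar>y\<bar>"
      have t: "t \<ge> 0" using a by (simp add: t_def)
      have "\<bar>\<Phi> z - \<Phi> y\<bar> \<le> (2 * a n) * B"
        unfolding \<theta>(3) abs_mult using zy B2[OF \<theta>(1)] by (intro mult_mono) auto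
      also have "\<dots> \<le> e' * B" using elim(2) B by (intro mult_right_mono) auto
      finally have diff: "\<bar>\<Phi> z - \<Phi> y\<bar> \<le> e' * B" .
      have T1: "\<bar>(h n y - 1 - a n * y * Q y) * \<Phi> z\<bar> \<le> (e' * t) * B"
        unfolding abs_mult[of _ "\<Phi> z"] using bspec[OF elim(3) y] B1[OF z] e' t
        by (intro mult_mono) (simp_all add: t_def mult.assoc)
      have T2: "\<bar>(z - y + a n * y) * \<Phi>' \<theta>\<bar> \<le> (e' * t) * B"
        unfolding abs_mult[of _ "\<Phi>' \<theta>"] using order_trans[OF zexp le(1)] B2[OF \<theta>(1)] e' t
        by (intro mult_mono) (simp_all add: t_def mult.assoc)
      have T3: "\<bar>(a n * y) * (\<Phi>' \<theta> - \<Phi>' y)\<bar> \<le> t * e'"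
        unfolding abs_mult using \<Phi>'_close a by (intro mult_mono) (auto simp: t_def)
      have T4: "\<bar>(a n * y) * Q y * (\<Phi> z - \<Phi> y)\<bar> \<le> t * B * (e' * B)"
        unfolding abs_mult using diff a B B3[OF y] by (intro mult_mono) (auto simp: t_def)
      \<comment> \<open>The term \<open>a n * y * Q y * \<Phi> z\<close> is split at
        \<open>\<Phi> y\<close> to bring in \<open>\<Phi>' y\<close>; the mean value theorem then
        replaces \<open>\<Phi> z - \<Phi> y\<close>, so that the first-order terms meet in the small
        factor \<open>z - y + a n * y\<close>.\<close>
      have "h n y * \<Phi> z - \<Phi> y = (h n y - 1 - a n * y * Q y) * \<Phi> z + (\<Phi> z - \<Phi> y)
               + a n * y * \<Phi>' y + (a n * y) * Q y * (\<Phi> z - \<Phi> y)"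
        by (simp add: \<Phi>'_def algebra_simps)
      also have "\<dots> = (h n y - 1 - a n * y * Q y) * \<Phi> z + (z - y + a n * y) * \<Phi>' \<theta>
               - (a n * y) * (\<Phi>' \<theta> - \<Phi>' y) + (a n * y) * Q y * (\<Phi> z - \<Phi> y)"
        unfolding \<theta>(3) by (simp add: algebra_simps)
      also have "\<bar>\<dots>\<bar> \<le> (e' * t) * B + (e' * t) * B + t * e' + t * B * (e' * B)"
        using T1 T2 T3 T4 by linarith
      also have "\<dots> = e' * (B + 1)\<^sup>2 * t" by (simp add: power2_eq_square algebra_simps)
      also have "\<dots> = e * a n * \<bar>y\<bar>" using B by (simp add: e'_def t_def)
      finally show "\<bar>h n y * \<Phi> (g n y) - \<Phi> y\<bar> \<le> e * a n * \<bar>y\<bar>" by (simp add: z_def)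
    qed
  qed
qed

section \<open>Convergence of the contracting recursion\<close>

text \<open>Follows from \<open>1 - t \<le> exp (- t)\<close>, since the partial sums of a divergent
  nonnegative series tend to infinity. The shift \<open>N\<close> allows the product to start only
  once the one-step error is small.\<close>

lemma prod_one_minus_tendsto_zero:
  fixes a :: "nat \<Rightarrow> real"
  assumes "\<And>n. 0 \<le> a n" "\<And>n. a n \<le> 1" "\<not> summable a"
  shows "(\<lambda>n. \<Prod>i<n. (1 - a (i + N))) \<longlonglongrightarrow> 0"
proof -
  have "\<not> summable (\<lambda>i. a (i + N))" using assms(3) by simp
  hence top: "filterlim (\<lambda>n. \<Sum>i<n. a (i + N)) at_top sequentially"
  proof (rule contrapos_np)
    assume *: "\<not> filterlim (\<lambda>n. \<Sum>i<n. a (i + N)) at_top sequentially"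
    then obtain Z where Z: "\<not> (\<forall>\<^sub>F n in sequentially. Z \<le> (\<Sum>i<n. a (i + N)))"
      by (auto simp: filterlim_at_top)
    have "(\<Sum>i<n. a (i + N)) \<le> Z" for n
    proof (rule ccontr)
      assume n: "\<not> (\<Sum>i<n. a (i + N)) \<le> Z"
      have "Z \<le> (\<Sum>i<m. a (i + N))" if "m \<ge> n" for m
        using n sum_mono2[of "{..<m}" "{..<n}" "\<lambda>i. a (i + N)"] that assms(1) by force
      with Z show False by (auto simp: eventually_sequentially)
    qed
    thus "summable (\<lambda>i. a (i + N))" using assms(1) by (intro summableI_nonneg_bounded)
  qed
  have "((\<lambda>x::real. exp (- x)) \<longlongrightarrow> 0) at_top"
    by (rule filterlim_compose[OF exp_at_bot filterlim_uminus_at_bot_at_top])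
  hence lim: "(\<lambda>n. exp (- (\<Sum>i<n. a (i + N)))) \<longlonglongrightarrow> 0"
    by (rule filterlim_compose[OF _ top])
  have "(\<Prod>i<n. (1 - a (i + N))) \<le> exp (- (\<Sum>i<n. a (i + N)))" for n
  proof -
    have "(\<Prod>i<n. (1 - a (i + N))) \<le> (\<Prod>i<n. exp (- a (i + N)))"
      using assms(2) exp_ge_add_one_self[of "- a _"] by (intro prod_mono) auto
    thus ?thesis by (simp add: exp_sum sum_negf[symmetric])
  qed
  moreover have "0 \<le> (\<Prod>i<n. (1 - a (i + N)))" for n using assms(2) by (intro prod_nonneg) auto
  ultimately show ?thesis by (intro tendsto_sandwich[OF _ _ tendsto_const lim]) auto
qed

lemma contracting_recursion_tendsto:
  fixes a D :: "nat \<Rightarrow> real" and \<Phi> :: "real \<Rightarrow> real" and g h \<phi> :: "nat \<Rightarrow> real \<Rightarrow> real"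
  assumes a: "\<And>n. 0 \<le> a n" "\<And>n. a n \<le> 1" "\<not> summable a"
    and rec: "\<And>n y. y \<in> {-r..0} \<Longrightarrow> \<phi> (Suc n) y = h n y * \<phi> n (g n y)"
    and phi0: "\<And>y. \<phi> 0 y = 1"
    and \<Phi>: "\<And>y. y \<in> {-r..0} \<Longrightarrow> \<bar>\<Phi> y - 1\<bar> \<le> B * \<bar>y\<bar>"
    and h01: "\<And>n y. y \<in> {-r..0} \<Longrightarrow> 0 \<le> h n y \<and> h n y \<le> 1"
    and h_lip: "\<And>n y. y \<in> {-r..0} \<Longrightarrow> \<bar>h n y - 1\<bar> \<le> D n * \<bar>y\<bar>"
    and g_range: "\<And>n y. y \<in> {-r..0} \<Longrightarrow> g n y \<in> {-r..0}"
    and g_contr: "\<And>n y. y \<in> {-r..0} \<Longrightarrow> \<bar>g n y\<bar> \<le> (1 - a n) * \<bar>y\<bar>"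
    and near: "\<And>e. e > 0 \<Longrightarrow> \<forall>\<^sub>F n in sequentially. \<forall>y\<in>{-r..0}.
                 \<bar>h n y * \<Phi> (g n y) - \<Phi> y\<bar> \<le> e * a n * \<bar>y\<bar>"
    and y: "y \<in> {-r..0}"
  shows "(\<lambda>n. \<phi> n y) \<longlonglongrightarrow> \<Phi> y"
proof -
  \<comment> \<open>This makes the weighted error finite. The constant may grow with
    \<open>n\<close>, which is harmless: it is used for a single generation \<open>N\<close>, as the
    initial value of the recursion.\<close>
  have lip: "\<exists>C\<ge>0. \<forall>y\<in>{-r..0}. \<bar>\<phi> n y - 1\<bar> \<le> C * \<bar>y\<bar>" for n
  proof (induction n)
    case 0 thus ?case by (auto simp: phi0 intro!: exI[of _ 0])
  next
    case (Suc n)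
    then obtain C where C: "C \<ge> 0" "\<And>y. y\<in>{-r..0} \<Longrightarrow> \<bar>\<phi> n y - 1\<bar> \<le> C * \<bar>y\<bar>" by auto
    have "\<bar>\<phi> (Suc n) y - 1\<bar> \<le> (C + \<bar>D n\<bar>) * \<bar>y\<bar>" if y: "y \<in> {-r..0}" for y
    proof -
      have "\<bar>g n y\<bar> \<le> 1 * \<bar>y\<bar>"
        using g_contr[OF y, of n] a(1)[of n] by (meson abs_ge_zero diff_le_eq le_add_same_cancel1 mult_right_mono order_trans)
      hence "C * \<bar>g n y\<bar> \<le> C * \<bar>y\<bar>" using C(1) by (intro mult_left_mono) auto
      hence "\<bar>\<phi> n (g n y) - 1\<bar> \<le> C * \<bar>y\<bar>" using C(2)[OF g_range[OF y], of n] by linarith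
      hence "\<bar>h n y * (\<phi> n (g n y) - 1)\<bar> \<le> 1 * (C * \<bar>y\<bar>)"
        unfolding abs_mult using h01[OF y, of n] C(1) by (intro mult_mono) auto
      moreover have "\<bar>h n y - 1\<bar> \<le> \<bar>D n\<bar> * \<bar>y\<bar>"
        using h_lip[OF y, of n] by (meson abs_ge_self abs_ge_zero mult_right_mono order_trans)
      moreover have "\<phi> (Suc n) y - 1 = h n y * (\<phi> n (g n y) - 1) + (h n y - 1)"
        using rec[OF y] by (simp add: algebra_simps)
      ultimately show ?thesis by (simp add: algebra_simps)
    qed
    thus ?case using C(1) by (intro exI[of _ "C + \<bar>D n\<bar>"]) auto
  qed
  show ?thesis
  proof (rule LIMSEQ_I)
    fix e :: real assume e: "e > 0"
    \<comment> \<open>The limiting bound is \<open>e' * \<bar>y\<bar>\<close>; the added 1 avoids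
      division by zero and the factor 2 leaves room for a strict inequality.\<close>
    define e' where "e' = e / (2 * (\<bar>y\<bar> + 1))"
    have e': "e' > 0" using e by (simp add: e'_def)
    from near[OF e'] obtain N where N: "\<And>n y. n \<ge> N \<Longrightarrow> y \<in> {-r..0} \<Longrightarrow>
        \<bar>h n y * \<Phi> (g n y) - \<Phi> y\<bar> \<le> e' * a n * \<bar>y\<bar>"
      unfolding eventually_sequentially by blast
    obtain C0 where C0: "\<And>y. y\<in>{-r..0} \<Longrightarrow> \<bar>\<phi> N y - 1\<bar> \<le> C0 * \<bar>y\<bar>" using lip by blast
    define C where "C = C0 + B"
    define p where "p m = (\<Prod>i<m. (1 - a (i + N)))" for m
    \<comment> \<open>The coefficient is the exact solution of
      \<open>K' = (1 - a n) * K + e' * a n\<close> with initial value \<open>C\<close>: the initial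
      error is damped by the product \<open>p m\<close>, and the accumulated one-step errors never
      exceed \<open>e'\<close>.\<close>
    have main: "\<bar>\<phi> (m + N) y - \<Phi> y\<bar> \<le> (C * p m + e' * (1 - p m)) * \<bar>y\<bar>" if "y \<in> {-r..0}" for m y
      using that
    proof (induction m arbitrary: y)
      case 0
      thus ?case using C0[of y] \<Phi>[of y] by (simp add: p_def C_def algebra_simps)
    next
      case (Suc m)
      define n where "n = m + N"
      define K where "K = C * p m + e' * (1 - p m)"
      note y = Suc.prems
      have g: "g n y \<in> {-r..0}" by (rule g_range[OF y])
      have IH: "\<bar>\<phi> n (g n y) - \<Phi> (g n y)\<bar> \<le> K * \<bar>g n y\<bar>"
        unfolding n_def K_def using Suc.IH g by (simp add: n_def)
      have "\<bar>\<phi> n (g n y) - \<Phi> (g n y)\<bar> \<le> K * ((1 - a n) * \<bar>y\<bar>)"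
      \<comment> \<open>Multiplying the contraction bound by \<open>K\<close> needs
        \<open>0 \<le> K\<close>, but \<open>C\<close> was obtained without a sign. If
        \<open>g n y\<close> is nonzero, the induction hypothesis at that point forces the sign; if
        it is zero, the left side vanishes and only the sign of the right side is at stake.\<close>
      proof (cases "g n y = 0")
        case True
        have "0 \<le> K \<or> y = 0" using Suc.IH[OF y] unfolding K_def[symmetric]
          by (smt (verit, best) abs_ge_zero mult_less_0_iff)
        moreover have "\<bar>\<phi> n (g n y) - \<Phi> (g n y)\<bar> \<le> 0" using IH True by simp
        ultimately show ?thesis using a(2)[of n] by (auto intro: order_trans)
      next
        case False
        have "0 \<le> K * \<bar>g n y\<bar>" using IH by linarith
        hence "0 \<le> K" using False by (simp add: zero_le_mult_iff)
        thus ?thesis using IH g_contr[OF y, of n] by (meson mult_left_mono order_trans)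
      qed
      hence "\<bar>h n y * (\<phi> n (g n y) - \<Phi> (g n y))\<bar> \<le> 1 * (K * ((1 - a n) * \<bar>y\<bar>))"
        unfolding abs_mult using h01[OF y, of n] by (intro mult_mono) auto
      moreover have "\<bar>h n y * \<Phi> (g n y) - \<Phi> y\<bar> \<le> e' * a n * \<bar>y\<bar>"
        by (rule N[OF _ y]) (simp add: n_def)
      moreover have "\<phi> (Suc n) y - \<Phi> y = h n y * (\<phi> n (g n y) - \<Phi> (g n y)) + (h n y * \<Phi> (g n y) - \<Phi> y)"
        using rec[OF y] by (simp add: algebra_simps)
      ultimately have "\<bar>\<phi> (Suc n) y - \<Phi> y\<bar> \<le> K * ((1 - a n) * \<bar>y\<bar>) + e' * a n * \<bar>y\<bar>"
        by linarith
      also have "\<dots> = (C * p (Suc m) + e' * (1 - p (Suc m))) * \<bar>y\<bar>"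
        by (simp add: K_def p_def n_def algebra_simps)
      finally show ?case by (simp add: n_def)
    qed
    have "p \<longlonglongrightarrow> 0" unfolding p_def by (rule prod_one_minus_tendsto_zero[OF a])
    hence "(\<lambda>m. (C * p m + e' * (1 - p m)) * \<bar>y\<bar>) \<longlonglongrightarrow> (C * 0 + e' * (1 - 0)) * \<bar>y\<bar>"
      by (intro tendsto_intros)
    moreover have "(C * 0 + e' * (1 - 0)) * \<bar>y\<bar> < e"
    proof -
      have "e * \<bar>y\<bar> < e * (2 * (\<bar>y\<bar> + 1))" using e by (intro mult_strict_left_mono) auto
      moreover have "2 * (\<bar>y\<bar> + 1) > 0" by (intro mult_pos_pos add_nonneg_pos) auto
      ultimately show ?thesis by (simp only: e'_def mult_zero_right add_0 diff_zero mult_1_right times_divide_eq_left pos_divide_less_eq)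
    qed
    ultimately have "\<forall>\<^sub>F m in sequentially. (C * p m + e' * (1 - p m)) * \<bar>y\<bar> < e"
      by (rule order_tendstoD(2))
    then obtain m0 where m0: "\<And>m. m \<ge> m0 \<Longrightarrow> (C * p m + e' * (1 - p m)) * \<bar>y\<bar> < e"
      by (auto simp: eventually_sequentially)
    show "\<exists>no. \<forall>n\<ge>no. norm (\<phi> n y - \<Phi> y) < e"
    proof (intro exI[of _ "m0 + N"] allI impI)
      fix n assume n: "n \<ge> m0 + N"
      hence "m0 \<le> n - N" "n - N + N = n" by auto
      thus "norm (\<phi> n y - \<Phi> y) < e"
        using main[OF y, of "n - N"] m0[of "n - N"] by simp
    qed
  qed
qed

section \<open>Factorial moments and generating functions\<close>

text \<open>Multiplying by \<open>1 + y\<close> turns the remainders for \<open>z\<close> into those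
  for \<open>Suc z\<close> by the same rule as Pascal's triangle, so their bounds add up to the next
  binomial coefficient. The range of \<open>y\<close> enters at \<open>K = 0\<close>, where it gives
  \<open>(1 + y) ^ Suc z \<le> 1\<close>.\<close>

lemma bonferroni_binomial:
  fixes y :: real
  assumes y: "y \<in> {-1..0}"
  shows "\<bar>(1 + y) ^ z - (\<Sum>j<K. real (z choose j) * y ^ j)\<bar> \<le> real (z choose K) * \<bar>y\<bar> ^ K"
proof (induction z arbitrary: K)
  case 0
  show ?case by (cases K) (auto simp: sum.lessThan_Suc_shift simp del: sum.lessThan_Suc)
next
  case (Suc z)
  show ?case
  proof (cases K)
    case 0
    thus ?thesis using y by (auto intro!: power_le_one mult_le_one simp: abs_mult)
  next
    case (Suc L)
    define D where "D K = (1 + y) ^ z - (\<Sum>j<K. real (z choose j) * y ^ j)" for K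
    have "(1 + y) ^ Suc z - (\<Sum>j<K. real (Suc z choose j) * y ^ j) = D (Suc L) + y * D L"
      unfolding Suc D_def
      by (simp add: sum.lessThan_Suc_shift del: sum.lessThan_Suc)
         (simp add: algebra_simps sum.distrib sum_distrib_left)
    also have "\<bar>\<dots>\<bar> \<le> \<bar>D (Suc L)\<bar> + \<bar>y\<bar> * \<bar>D L\<bar>"
      using abs_triangle_ineq[of "D (Suc L)" "y * D L"] by (simp add: abs_mult)
    also have "\<dots> \<le> real (z choose Suc L) * \<bar>y\<bar> ^ Suc L + \<bar>y\<bar> * (real (z choose L) * \<bar>y\<bar> ^ L)"
      unfolding D_def by (intro add_mono mult_left_mono Suc.IH) auto
    also have "\<dots> = real (Suc z choose K) * \<bar>y\<bar> ^ K" by (simp add: Suc algebra_simps)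
    finally show ?thesis .
  qed
qed

lemma falling_fact_eq: "falling_fact k z = fact k * real (z choose k)"
  unfolding falling_fact_def binomial_gbinomial gbinomial_prod_rev
  by (simp add: atLeast0LessThan)

lemma fact_moment_nonneg: "fact_moment M Z k \<ge> 0"
  unfolding fact_moment_def falling_fact_eq by (intro Bochner_Integration.integral_nonneg) simp

context prob_space
begin

lemma integrable_pgf:
  assumes [measurable]: "Z \<in> measurable M (count_space UNIV)" and "0 \<le> x" "x \<le> 1"
  shows "integrable M (\<lambda>\<omega>. x ^ Z \<omega> :: real)"
  using assms by (intro integrable_const_bound[where B = 1]) (auto simp: power_le_one)

lemma pgf_range:
  assumes "Z \<in> measurable M (count_space UNIV)" "0 \<le> x" "x \<le> 1"
  shows "0 \<le> expectation (\<lambda>\<omega>. x ^ Z \<omega> :: real)" "expectation (\<lambda>\<omega>. x ^ Z \<omega>) \<le> 1"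
proof -
  show "0 \<le> expectation (\<lambda>\<omega>. x ^ Z \<omega> :: real)" using assms by (intro Bochner_Integration.integral_nonneg) auto
  have "expectation (\<lambda>\<omega>. x ^ Z \<omega>) \<le> expectation (\<lambda>\<omega>. 1)"
    using assms by (intro integral_mono integrable_pgf) (auto simp: power_le_one)
  thus "expectation (\<lambda>\<omega>. x ^ Z \<omega>) \<le> 1" by (simp add: prob_space)
qed

text \<open>The expectation of the pointwise Bonferroni bound. It replaces Taylor's formula at the
  boundary point 1, so no derivative of a generating function has to be formed, and the remainder
  involves one factorial moment only.\<close>

lemma pgf_factorial_moment_expansion:
  assumes Z: "Z \<in> measurable M (count_space UNIV)" and y: "y \<in> {-1..0}"
    and int: "\<And>j. j \<le> K \<Longrightarrow> integrable M (\<lambda>\<omega>. falling_fact j (Z \<omega>))"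
  shows "\<bar>expectation (\<lambda>\<omega>. (1 + y) ^ Z \<omega>) - (\<Sum>j<K. fact_moment M Z j / fact j * y ^ j)\<bar>
           \<le> fact_moment M Z K / fact K * \<bar>y\<bar> ^ K"
proof -
  have int': "integrable M (\<lambda>\<omega>. real (Z \<omega> choose j))" if "j \<le> K" for j
    using int[OF that] by (simp add: falling_fact_eq)
  have m: "fact_moment M Z j / fact j = expectation (\<lambda>\<omega>. real (Z \<omega> choose j))" for j
    by (simp add: fact_moment_def falling_fact_eq)
  have intp: "integrable M (\<lambda>\<omega>. (1 + y) ^ Z \<omega>)"
    using y by (intro integrable_pgf Z) auto
  have ints: "integrable M (\<lambda>\<omega>. \<Sum>j<K. real (Z \<omega> choose j) * y ^ j)"
    by (intro Bochner_Integration.integrable_sum integrable_mult_left int') auto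
  have "expectation (\<lambda>\<omega>. (1 + y) ^ Z \<omega>) - (\<Sum>j<K. fact_moment M Z j / fact j * y ^ j)
      = expectation (\<lambda>\<omega>. (1 + y) ^ Z \<omega> - (\<Sum>j<K. real (Z \<omega> choose j) * y ^ j))"
    by (simp add: m intp ints int')
  also have "\<bar>\<dots>\<bar> \<le> expectation (\<lambda>\<omega>. \<bar>(1 + y) ^ Z \<omega> - (\<Sum>j<K. real (Z \<omega> choose j) * y ^ j)\<bar>)"
    by (rule integral_abs_bound)
  also have "\<dots> \<le> expectation (\<lambda>\<omega>. real (Z \<omega> choose K) * \<bar>y\<bar> ^ K)"
    using y by (intro integral_mono integrable_abs Bochner_Integration.integrable_diff intp ints
        integrable_mult_left int' bonferroni_binomial) auto
  also have "\<dots> = fact_moment M Z K / fact K * \<bar>y\<bar> ^ K" by (simp add: m)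
  finally show ?thesis .
qed

text \<open>The partial sums are expectations of \<open>f\<close> restricted to
  \<open>Z < n\<close>, and \<open>\<bar>f\<bar>\<close> dominates them. This is the conditioning
  device for sums with a random number of terms.\<close>

lemma expectation_split_nat:
  fixes f :: "'a \<Rightarrow> real"
  assumes Z [measurable]: "Z \<in> measurable M (count_space (UNIV :: nat set))" and f: "integrable M f"
  shows "(\<lambda>k. expectation (\<lambda>\<omega>. of_bool (Z \<omega> = k) * f \<omega>)) sums expectation f"
  unfolding sums_def
proof -
  have [measurable]: "f \<in> borel_measurable M" using f by auto
  have int: "integrable M (\<lambda>\<omega>. of_bool (Z \<omega> = k) * f \<omega>)" for k
    by (rule Bochner_Integration.integrable_bound[OF f]) auto
  have "(\<Sum>k<n. expectation (\<lambda>\<omega>. of_bool (Z \<omega> = k) * f \<omega>))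
      = expectation (\<lambda>\<omega>. of_bool (Z \<omega> < n) * f \<omega>)" for n
  proof -
    have "(\<Sum>k<n. expectation (\<lambda>\<omega>. of_bool (Z \<omega> = k) * f \<omega>))
        = expectation (\<lambda>\<omega>. \<Sum>k<n. of_bool (Z \<omega> = k) * f \<omega>)"
      by (rule Bochner_Integration.integral_sum[symmetric]) (rule int)
    also have "(\<lambda>\<omega>. \<Sum>k<n. of_bool (Z \<omega> = k) * f \<omega>) = (\<lambda>\<omega>. of_bool (Z \<omega> < n) * f \<omega>)"
      by (auto simp: fun_eq_iff sum_distrib_right[symmetric] of_bool_def)
    finally show ?thesis .
  qed
  moreover have "(\<lambda>n. expectation (\<lambda>\<omega>. of_bool (Z \<omega> < n) * f \<omega>)) \<longlonglongrightarrow> expectation f"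
  proof (rule integral_dominated_convergence[where w = "\<lambda>\<omega>. \<bar>f \<omega>\<bar>"])
    show "AE \<omega> in M. (\<lambda>n. of_bool (Z \<omega> < n) * f \<omega>) \<longlonglongrightarrow> f \<omega>"
    proof (rule AE_I2)
      fix \<omega>
      have "\<forall>\<^sub>F n in sequentially. of_bool (Z \<omega> < n) * f \<omega> = f \<omega>"
        using eventually_gt_at_top[of "Z \<omega>"] by eventually_elim simp
      thus "(\<lambda>n. of_bool (Z \<omega> < n) * f \<omega>) \<longlonglongrightarrow> f \<omega>" by (rule tendsto_eventually)
    qed
  qed (use f in auto)
  ultimately show "(\<lambda>n. \<Sum>k<n. expectation (\<lambda>\<omega>. of_bool (Z \<omega> = k) * f \<omega>)) \<longlonglongrightarrow> expectation f"
    by simp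
qed

lemma expectation_of_bool_eq:
  assumes [measurable]: "Z \<in> measurable M (count_space (UNIV :: nat set))"
  shows "expectation (\<lambda>\<omega>. of_bool (Z \<omega> = k)) = prob (Z -` {k} \<inter> space M)"
proof -
  have "expectation (\<lambda>\<omega>. of_bool (Z \<omega> = k)) = expectation (indicator (Z -` {k} \<inter> space M))"
    by (intro Bochner_Integration.integral_cong) (auto simp: indicator_def)
  also have "\<dots> = prob (Z -` {k} \<inter> space M)" by simp
  finally show ?thesis .
qed

lemma pgf_sums:
  assumes Z: "Z \<in> measurable M (count_space (UNIV :: nat set))" and "0 \<le> x" "x \<le> 1"
  shows "(\<lambda>k. prob (Z -` {k} \<inter> space M) * x ^ k) sums expectation (\<lambda>\<omega>. x ^ Z \<omega> :: real)"
proof -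
  have "expectation (\<lambda>\<omega>. of_bool (Z \<omega> = k) * x ^ Z \<omega>) = prob (Z -` {k} \<inter> space M) * x ^ k" for k
  proof -
    have "expectation (\<lambda>\<omega>. of_bool (Z \<omega> = k) * x ^ Z \<omega>) = expectation (\<lambda>\<omega>. of_bool (Z \<omega> = k) * x ^ k)"
      by (intro Bochner_Integration.integral_cong) auto
    thus ?thesis by (simp add: expectation_of_bool_eq[OF Z])
  qed
  thus ?thesis using expectation_split_nat[OF Z integrable_pgf[OF assms]] by simp
qed

end

section \<open>The process and the recursion for its generating function\<close>

text \<open>The random upper limit of the sum is handled by its countably many values. Only
  generations up to \<open>n\<close> are assumed measurable, so that the lemma also applies on a
  product space carrying just those coordinates.\<close>

lemma measurable_bpi:
  assumes "\<And>m j. 1 \<le> m \<Longrightarrow> m \<le> n \<Longrightarrow> 1 \<le> j \<Longrightarrow> xi m j \<in> measurable N (count_space UNIV)"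
    and "\<And>m. 1 \<le> m \<Longrightarrow> m \<le> n \<Longrightarrow> eps m \<in> measurable N (count_space UNIV)"
  shows "bpi xi eps n \<in> measurable N (count_space UNIV)"
  using assms
proof (induction n)
  case 0
  have "bpi xi eps 0 = (\<lambda>_. 0)" by auto
  thus ?case by simp
next
  case (Suc n)
  have IH [measurable]: "bpi xi eps n \<in> measurable N (count_space UNIV)"
    using Suc.prems by (intro Suc.IH) auto
  have "(\<lambda>\<omega>. (\<Sum>j = 1..k. xi (Suc n) j \<omega>)) \<in> measurable N (count_space UNIV)" for k
  proof (induction k)
    case (Suc k)
    have [measurable]: "xi (Suc n) (Suc k) \<in> measurable N (count_space UNIV)"
      using Suc.prems by (intro \<open>\<And>m j. 1 \<le> m \<Longrightarrow> m \<le> Suc n \<Longrightarrow> 1 \<le> j \<Longrightarrow> xi m j \<in> _\<close>) auto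
    note Suc.IH [measurable]
    show ?case by (simp del: One_nat_def)
  qed simp
  hence [measurable]: "(\<lambda>\<omega>. \<Sum>j = 1..bpi xi eps n \<omega>. xi (Suc n) j \<omega>) \<in> measurable N (count_space UNIV)"
    by (rule measurable_compose_countable[OF _ IH])
  have [measurable]: "eps (Suc n) \<in> measurable N (count_space UNIV)"
    using Suc.prems by simp
  have "bpi xi eps (Suc n) = (\<lambda>\<omega>. (\<Sum>j = 1..bpi xi eps n \<omega>. xi (Suc n) j \<omega>) + eps (Suc n) \<omega>)" by auto
  thus ?case by (simp del: One_nat_def)
qed

lemma bpi_cong:
  assumes "\<And>m j. 1 \<le> m \<Longrightarrow> m \<le> n \<Longrightarrow> 1 \<le> j \<Longrightarrow> xi m j \<omega> = xi' m j \<omega>'"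
    and "\<And>m. 1 \<le> m \<Longrightarrow> m \<le> n \<Longrightarrow> eps m \<omega> = eps' m \<omega>'"
  shows "bpi xi eps n \<omega> = bpi xi' eps' n \<omega>'"
  using assms by (induction n) auto

text \<open>On the event that generation \<open>n\<close> has size \<open>k\<close>, the next size
  is a sum of \<open>k + 1\<close> fixed variables, all independent of that event. Each event thus
  contributes its probability times \<open>G ^ k * H\<close>, and summing over \<open>k\<close>
  gives the generating function of generation \<open>n\<close> at \<open>G\<close>.\<close>

lemma (in prob_space) bpi_pgf_recursion:
  assumes meas_xi: "\<And>n j. n \<ge> 1 \<Longrightarrow> j \<ge> 1 \<Longrightarrow> xi n j \<in> measurable M (count_space UNIV)"
    and meas_eps: "\<And>n. n \<ge> 1 \<Longrightarrow> eps n \<in> measurable M (count_space UNIV)"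
    and indep: "indep_vars (\<lambda>_. count_space UNIV)
          (\<lambda>i. case i of Inl (n, j) \<Rightarrow> xi n j | Inr n \<Rightarrow> eps n)
          ({(n, j). n \<ge> 1 \<and> j \<ge> 1} <+> {n. n \<ge> 1})"
    and ident: "\<And>n j. n \<ge> 1 \<Longrightarrow> j \<ge> 1 \<Longrightarrow>
          distr M (count_space UNIV) (xi n j) = distr M (count_space UNIV) (xi n 1)"
    and x: "0 \<le> x" "x \<le> (1::real)"
  shows "expectation (\<lambda>\<omega>. x ^ bpi xi eps (Suc n) \<omega>) = 
    expectation (\<lambda>\<omega>. x ^ eps (Suc n) \<omega>) * 
    expectation (\<lambda>\<omega>. expectation (\<lambda>\<omega>. x ^ xi (Suc n) 1 \<omega>) ^ bpi xi eps n \<omega>)"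
proof -
  define V where "V = (\<lambda>i. case i of Inl (n, j) \<Rightarrow> xi n j | Inr n \<Rightarrow> eps n)"
  define I where "I = ({(n, j). n \<ge> 1 \<and> j \<ge> 1} <+> {n. n \<ge> (1::nat)} :: (nat \<times> nat + nat) set)"
  note indep' = indep[folded V_def I_def]
  define G where "G = expectation (\<lambda>\<omega>. x ^ xi (Suc n) 1 \<omega>)"
  define H where "H = expectation (\<lambda>\<omega>. x ^ eps (Suc n) \<omega>)"
  have V_meas: "V i \<in> measurable M (count_space UNIV)" if "i \<in> I" for i
    using that meas_xi meas_eps by (auto simp: V_def I_def)
  have bpi_meas: "bpi xi eps m \<in> measurable M (count_space UNIV)" for m
    using meas_xi meas_eps by (intro measurable_bpi)
  have xi_pgf: "expectation (\<lambda>\<omega>. x ^ xi (Suc n) j \<omega>) = G" if j: "j \<ge> 1" for j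
  proof -
    have "expectation (\<lambda>\<omega>. x ^ xi (Suc n) j \<omega>) = (\<integral>k. x ^ k \<partial>distr M (count_space UNIV) (xi (Suc n) j))"
      using j meas_xi by (intro integral_distr[symmetric]) auto
    also have "\<dots> = (\<integral>k. x ^ k \<partial>distr M (count_space UNIV) (xi (Suc n) 1))"
      using j by (subst ident) auto
    also have "\<dots> = G" unfolding G_def using meas_xi by (intro integral_distr) auto
    finally show ?thesis .
  qed
  define X where "X = bpi xi eps n"
  have summand: "expectation (\<lambda>\<omega>. of_bool (X \<omega> = k) * x ^ bpi xi eps (Suc n) \<omega>)
       = prob (X -` {k} \<inter> space M) * G ^ k * H" for k
  proof -
    \<comment> \<open>\<open>A\<close> indexes all variables of the past, \<open>B\<close> the
      finitely many that enter generation \<open>Suc n\<close> when its predecessor has size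
      \<open>k\<close>; disjointness gives independence of the two blocks.\<close>
    define A where "A = {i \<in> I. case i of Inl (m, j) \<Rightarrow> m \<le> n | Inr m \<Rightarrow> m \<le> n}"
    define B :: "(nat \<times> nat + nat) set" where "B = insert (Inr (Suc n)) ((\<lambda>j. Inl (Suc n, j)) ` {1..k})"
    have AB: "A \<inter> B = {}" "A \<subseteq> I" "B \<subseteq> I" by (auto simp: A_def B_def I_def)
    have finB: "finite B" by (simp add: B_def)
    \<comment> \<open>Running \<open>bpi\<close> on the coordinate projections exhibits the event as
      a measurable function of the family restricted to \<open>A\<close>, the form that independence
      of blocks requires.\<close>
    define Y1 :: "(nat \<times> nat + nat \<Rightarrow> nat) \<Rightarrow> real" where
      "Y1 f = of_bool (bpi (\<lambda>m j f. f (Inl (m, j))) (\<lambda>m f. f (Inr m)) n f = k)" for f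
    define Y2 :: "(nat \<times> nat + nat \<Rightarrow> nat) \<Rightarrow> real" where "Y2 f = (\<Prod>i\<in>B. x ^ f i)" for f
    have [measurable]: "bpi (\<lambda>m j f. f (Inl (m, j))) (\<lambda>m f. f (Inr m)) n \<in>
        measurable (PiM A (\<lambda>_. count_space UNIV)) (count_space (UNIV :: nat set))"
      by (intro measurable_bpi measurable_component_singleton) (auto simp: A_def I_def)
    have Y1 [measurable]: "Y1 \<in> borel_measurable (PiM A (\<lambda>_. count_space UNIV))"
      unfolding Y1_def by measurable
    have Y2 [measurable]: "Y2 \<in> borel_measurable (PiM B (\<lambda>_. count_space UNIV))"
    proof -
      have "(\<lambda>f. x ^ f i) \<in> borel_measurable (PiM B (\<lambda>_. count_space (UNIV :: nat set)))" if "i \<in> B" for i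
        by (rule measurable_compose[OF measurable_component_singleton[OF that]]) simp
      thus ?thesis unfolding Y2_def by (intro borel_measurable_prod)
    qed
    have "indep_var borel (Y1 \<circ> (\<lambda>\<omega>. restrict (\<lambda>i. V i \<omega>) A)) borel (Y2 \<circ> (\<lambda>\<omega>. restrict (\<lambda>i. V i \<omega>) B))"
      by (rule indep_var_compose[OF indep_var_restrict[OF indep' AB] Y1 Y2])
    also have "Y1 \<circ> (\<lambda>\<omega>. restrict (\<lambda>i. V i \<omega>) A) = (\<lambda>\<omega>. of_bool (X \<omega> = k))"
    proof
      fix \<omega>
      have "bpi (\<lambda>m j f. f (Inl (m, j))) (\<lambda>m f. f (Inr m)) n (restrict (\<lambda>i. V i \<omega>) A) = X \<omega>"
        unfolding X_def by (intro bpi_cong) (auto simp: A_def I_def V_def)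
      thus "(Y1 \<circ> (\<lambda>\<omega>. restrict (\<lambda>i. V i \<omega>) A)) \<omega> = of_bool (X \<omega> = k)" by (simp add: Y1_def)
    qed
    also have "Y2 \<circ> (\<lambda>\<omega>. restrict (\<lambda>i. V i \<omega>) B) = (\<lambda>\<omega>. \<Prod>i\<in>B. x ^ V i \<omega>)"
      by (auto simp: Y2_def fun_eq_iff intro!: prod.cong)
    finally have ind: "indep_var borel (\<lambda>\<omega>. of_bool (X \<omega> = k) :: real) borel (\<lambda>\<omega>. \<Prod>i\<in>B. x ^ V i \<omega>)" .
    have V_int: "integrable M (\<lambda>\<omega>. x ^ V i \<omega>)" if "i \<in> B" for i
      using that AB x V_meas by (intro integrable_pgf) auto
    have indB: "indep_vars (\<lambda>_. borel) (\<lambda>i \<omega>. x ^ V i \<omega>) B"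
      by (rule indep_vars_compose2[OF indep_vars_subset[OF indep' AB(3)]]) auto
    have [measurable]: "X \<in> measurable M (count_space UNIV)" unfolding X_def by (rule bpi_meas)
    have "expectation (\<lambda>\<omega>. of_bool (X \<omega> = k) * x ^ bpi xi eps (Suc n) \<omega>)
        = expectation (\<lambda>\<omega>. of_bool (X \<omega> = k) * (\<Prod>i\<in>B. x ^ V i \<omega>))"
    proof (intro Bochner_Integration.integral_cong refl)
      fix \<omega>
      have "(\<Prod>i\<in>B. x ^ V i \<omega>) = x ^ eps (Suc n) \<omega> * (\<Prod>j=1..k. x ^ xi (Suc n) j \<omega>)"
        unfolding B_def by (subst prod.insert) (auto simp: prod.reindex inj_on_def V_def)
      also have "\<dots> = x ^ ((\<Sum>j=1..k. xi (Suc n) j \<omega>) + eps (Suc n) \<omega>)"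
        by (simp add: power_add power_sum)
      finally show "of_bool (X \<omega> = k) * x ^ bpi xi eps (Suc n) \<omega> = of_bool (X \<omega> = k) * (\<Prod>i\<in>B. x ^ V i \<omega>)"
        by (auto simp: X_def)
    qed
    also have "\<dots> = expectation (\<lambda>\<omega>. of_bool (X \<omega> = k)) * expectation (\<lambda>\<omega>. \<Prod>i\<in>B. x ^ V i \<omega>)"
    proof (rule indep_var_lebesgue_integral[OF ind])
      show "integrable M (\<lambda>\<omega>. of_bool (X \<omega> = k) :: real)"
        by (intro integrable_const_bound[where B = 1]) auto
      show "integrable M (\<lambda>\<omega>. \<Prod>i\<in>B. x ^ V i \<omega>)"
        by (rule indep_vars_integrable[OF finB indB V_int])
    qed
    also have "expectation (\<lambda>\<omega>. \<Prod>i\<in>B. x ^ V i \<omega>) = (\<Prod>i\<in>B. expectation (\<lambda>\<omega>. x ^ V i \<omega>))"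
      by (rule indep_vars_lebesgue_integral[OF finB indB V_int])
    also have "\<dots> = H * (\<Prod>j=1..k. expectation (\<lambda>\<omega>. x ^ xi (Suc n) j \<omega>))"
      unfolding B_def by (subst prod.insert) (auto simp: prod.reindex inj_on_def V_def H_def)
    also have "(\<Prod>j=1..k. expectation (\<lambda>\<omega>. x ^ xi (Suc n) j \<omega>)) = G ^ k"
      using xi_pgf by simp
    finally show ?thesis by (simp add: expectation_of_bool_eq mult_ac)
  qed
  have X_meas: "X \<in> measurable M (count_space UNIV)" unfolding X_def by (rule bpi_meas)
  have "(\<lambda>k. prob (X -` {k} \<inter> space M) * G ^ k * H) sums expectation (\<lambda>\<omega>. x ^ bpi xi eps (Suc n) \<omega>)"
    using expectation_split_nat[OF X_meas integrable_pgf[OF bpi_meas x, of "Suc n"]] by (simp add: summand del: bpi.simps)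
  moreover have "(\<lambda>k. prob (X -` {k} \<inter> space M) * G ^ k * H) sums (expectation (\<lambda>\<omega>. G ^ X \<omega>) * H)"
    using pgf_range[OF meas_xi x, of "Suc n" 1]
    by (intro sums_mult2 pgf_sums X_meas) (auto simp: G_def)
  ultimately show ?thesis
    unfolding G_def[symmetric] H_def[symmetric] X_def[symmetric]
    by (simp add: sums_unique2 mult.commute)
qed

section \<open>From generating functions to convergence in distribution\<close>

text \<open>Coefficient \<open>k\<close> can be read off at a small fixed \<open>x\<close>: subtract
  the earlier terms and divide by \<open>x ^ k\<close>. The error is at most
  \<open>x / (1 - x)\<close> for every \<open>n\<close>, so strong induction on \<open>k\<close>
  gives convergence without extracting subsequences. The condition on \<open>F\<close> at 1 ensures
  that the limits have total mass 1.\<close>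

lemma pgf_coefficients_converge:
  fixes p :: "nat \<Rightarrow> nat \<Rightarrow> real" and f :: "nat \<Rightarrow> real \<Rightarrow> real"
  assumes nonneg: "\<And>n k. 0 \<le> p n k" and le1: "\<And>n K. (\<Sum>k<K. p n k) \<le> 1"
    and sums: "\<And>n x. x \<in> {0<..<1} \<Longrightarrow> (\<lambda>k. p n k * x ^ k) sums f n x"
    and lim: "\<And>x. x \<in> {0<..<1} \<Longrightarrow> (\<lambda>n. f n x) \<longlonglongrightarrow> F x"
    and F1: "(F \<longlongrightarrow> 1) (at_left 1)"
  obtains q where "\<And>k. (\<lambda>n. p n k) \<longlonglongrightarrow> q k" "\<And>k. 0 \<le> q k" "q sums 1"
    "\<And>x. x \<in> {0<..<1} \<Longrightarrow> (\<lambda>k. q k * x ^ k) sums F x"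
proof -
  have p1: "p n k \<le> 1" for n k
  proof -
    have "p n k \<le> (\<Sum>k<Suc k. p n k)" using sum_nonneg[of "{..<k}" "p n"] nonneg by simp
    thus ?thesis using le1[of n "Suc k"] by linarith
  qed
  have tail: "0 \<le> f n x - (\<Sum>k<K. p n k * x ^ k) \<and> f n x - (\<Sum>k<K. p n k * x ^ k) \<le> x ^ K / (1 - x)"
    if x: "x \<in> {0<..<1}" for n x K
  proof -
    have s: "(\<lambda>k. p n (k + K) * x ^ (k + K)) sums (f n x - (\<Sum>k<K. p n k * x ^ k))"
      using sums_split_initial_segment[OF sums[OF x]] .
    have "(\<lambda>k. x ^ K * x ^ k) sums (x ^ K * (1 / (1 - x)))"
      using x by (intro sums_mult geometric_sums) auto
    hence g: "(\<lambda>k. x ^ (k + K)) sums (x ^ K / (1 - x))" by (simp add: power_add mult.commute)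
    have "p n (k + K) * x ^ (k + K) \<le> x ^ (k + K)" for k
      using x p1[of n "k + K"] nonneg[of n "k + K"] by (intro mult_left_le_one_le) auto
    thus ?thesis
      using sums_le[OF _ s g] sums_le[OF _ sums_zero s] x nonneg by simp
  qed
  have conv: "convergent (\<lambda>n. p n k)" for k
  proof (induction k rule: less_induct)
    case (less k)
    have "Cauchy (\<lambda>n. p n k)"
    proof (rule CauchyI)
      fix e :: real assume e: "e > 0"
      \<comment> \<open>Chosen so that \<open>x / (1 - x)\<close> equals \<open>e / 4\<close>; the
        two approximation errors then leave \<open>e / 2\<close> for the Cauchy sequence
        \<open>S\<close>.\<close>
      define x where "x = e / (e + 4)"
      have x: "x \<in> {0<..<1}" using e by (auto simp: x_def field_simps)
      have xe: "x / (1 - x) = e / 4" using e by (simp add: x_def field_simps)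
      define S where "S n = (f n x - (\<Sum>j<k. p n j * x ^ j)) / x ^ k" for n
      have close: "\<bar>S n - p n k\<bar> \<le> e / 4" for n
      proof -
        have "S n * x ^ k = f n x - (\<Sum>j<k. p n j * x ^ j)" using x by (simp add: S_def)
        hence "0 \<le> (S n - p n k) * x ^ k \<and> (S n - p n k) * x ^ k \<le> (x / (1 - x)) * x ^ k"
          using tail[OF x, of n "Suc k"] x by (simp add: left_diff_distrib)
        moreover have "x ^ k > 0" using x by simp
        ultimately show ?thesis unfolding xe
          using mult_right_le_imp_le[of "S n - p n k" "x ^ k" "e / 4"] zero_le_mult_iff[of "S n - p n k" "x ^ k"]
          by linarith
      qed
      have "convergent S" unfolding S_def divide_inverse
        using less lim[OF x] x
        by (intro convergent_mult convergent_diff convergent_sum convergent_const)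
           (auto simp: convergent_def intro!: less[unfolded convergent_def])
      hence "Cauchy S" by (rule convergent_Cauchy)
      then obtain N where N: "\<And>m n. m \<ge> N \<Longrightarrow> n \<ge> N \<Longrightarrow> \<bar>S m - S n\<bar> < e / 2"
        using e unfolding Cauchy_iff by (metis half_gt_zero real_norm_def)
      have "norm (p m k - p n k) < e" if "m \<ge> N" "n \<ge> N" for m n
        using N[OF that] close[of m] close[of n] unfolding real_norm_def by argo
      thus "\<exists>M. \<forall>m\<ge>M. \<forall>n\<ge>M. norm (p m k - p n k) < e" by blast
    qed
    thus ?case by (rule Cauchy_convergent)
  qed
  then obtain q where q: "\<And>k. (\<lambda>n. p n k) \<longlonglongrightarrow> q k" unfolding convergent_def by metis
  have q0: "0 \<le> q k" for k by (rule LIMSEQ_le_const[OF q]) (use nonneg in auto)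
  have qsums: "(\<lambda>k. q k * x ^ k) sums F x" if x: "x \<in> {0<..<1}" for x
  proof -
    have l: "(\<lambda>n. f n x - (\<Sum>k<K. p n k * x ^ k)) \<longlonglongrightarrow> F x - (\<Sum>k<K. q k * x ^ k)" for K
      by (intro tendsto_intros lim x q)
    have bounds: "0 \<le> F x - (\<Sum>k<K. q k * x ^ k)" "F x - (\<Sum>k<K. q k * x ^ k) \<le> x ^ K / (1 - x)" for K
      using tail[OF x] by (blast intro: LIMSEQ_le_const[OF l] LIMSEQ_le_const2[OF l])+
    have geo: "(\<lambda>K. x ^ K / (1 - x)) \<longlonglongrightarrow> 0"
      using x tendsto_divide_zero[OF LIMSEQ_realpow_zero[of x]] by simp
    have "(\<lambda>K. F x - (\<Sum>k<K. q k * x ^ k)) \<longlonglongrightarrow> 0"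
      by (rule tendsto_sandwich[OF _ _ tendsto_const geo]) (intro always_eventually allI bounds)+
    from tendsto_diff[OF tendsto_const[of "F x"] this] show ?thesis by (simp add: sums_def)
  qed
  have qle: "(\<Sum>k<K. q k) \<le> 1" for K
    by (rule LIMSEQ_le_const2[OF tendsto_sum[OF q]]) (use le1 in auto)
  have qsm: "summable q" by (rule summableI_nonneg_bounded[OF q0 qle])
  have "suminf q \<le> 1" by (rule suminf_le_const[OF qsm qle])
  \<comment> \<open>Abel's argument: every \<open>F x\<close> with \<open>x < 1\<close> is at most
    the total mass, and \<open>F x\<close> tends to 1.\<close>
  moreover have "1 \<le> suminf q"
  proof (rule tendsto_upperbound[OF F1])
    have "F x \<le> suminf q" if x: "x \<in> {0<..<1}" for x
      using x q0 by (intro sums_le[OF _ qsums[OF x] summable_sums[OF qsm]])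
        (auto intro!: mult_right_le_one_le power_le_one)
    thus "\<forall>\<^sub>F x in at_left 1. F x \<le> suminf q"
      by (intro eventually_at_leftI[of 0]) auto
  qed auto
  ultimately have "q sums 1" using summable_sums[OF qsm] by simp
  thus ?thesis using that q q0 qsums by blast
qed

lemma pmf_of_nat_weights:
  fixes q :: "nat \<Rightarrow> real"
  assumes "\<And>k. 0 \<le> q k" "q sums 1"
  obtains Y where "\<And>k. pmf Y k = q k"
proof
  have "(\<integral>\<^sup>+ k. ennreal (q k) \<partial>count_space UNIV) = 1"
    using assms by (simp add: nn_integral_count_space_nat suminf_ennreal_eq sums_unique[symmetric])
  thus "pmf (embed_pmf q) k = q k" for k using assms by (intro pmf_embed_pmf) auto
qed

lemma (in prob_space) cdf_nat_valued:
  assumes [measurable]: "Z \<in> measurable M (count_space (UNIV :: nat set))"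
  shows "cdf (distr M borel (\<lambda>\<omega>. real (Z \<omega>))) t = (\<Sum>k | real k \<le> t. prob (Z -` {k} \<inter> space M))"
proof -
  have fin: "finite {k. real k \<le> t}"
    by (rule finite_subset[of _ "{..nat \<lfloor>t\<rfloor>}"]) (auto simp: le_nat_floor)
  have "cdf (distr M borel (\<lambda>\<omega>. real (Z \<omega>))) t = prob ((\<lambda>\<omega>. real (Z \<omega>)) -` {..t} \<inter> space M)"
    unfolding cdf_def by (subst measure_distr) auto
  also have "(\<lambda>\<omega>. real (Z \<omega>)) -` {..t} \<inter> space M = (\<Union>k\<in>{k. real k \<le> t}. Z -` {k} \<inter> space M)" by auto
  also have "prob \<dots> = (\<Sum>k | real k \<le> t. prob (Z -` {k} \<inter> space M))"
    by (rule finite_measure_finite_Union[OF fin]) (auto simp: disjoint_family_on_def)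
  finally show ?thesis .
qed

text \<open>For variables with values in the naturals, the distribution function at \<open>t\<close>
  is a finite sum of point masses. Convergence of the point masses therefore gives convergence at
  every \<open>t\<close>, continuity point or not.\<close>

lemma (in prob_space) weak_conv_of_pgf_tendsto:
  fixes X :: "nat \<Rightarrow> 'a \<Rightarrow> nat"
  assumes X: "\<And>n. X n \<in> measurable M (count_space UNIV)"
    and lim: "\<And>x. x \<in> {0<..<1} \<Longrightarrow> (\<lambda>n. expectation (\<lambda>\<omega>. x ^ X n \<omega>)) \<longlonglongrightarrow> F x"
    and F1: "(F \<longlongrightarrow> 1) (at_left 1)"
  shows "\<exists>Y :: nat pmf. weak_conv_m (\<lambda>n. distr M borel (\<lambda>\<omega>. real (X n \<omega>)))
                       (distr (measure_pmf Y) borel real)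
         \<and> (\<forall>x \<in> {0<..<1::real}. measure_pmf.expectation Y (\<lambda>k. x ^ k) = F x)"
proof -
  define p where "p n k = prob (X n -` {k} \<inter> space M)" for n k
  have le1: "(\<Sum>k<K. p n k) \<le> 1" for n K
  proof -
    have "(\<Sum>k<K. p n k) = prob (\<Union>k\<in>{..<K}. X n -` {k} \<inter> space M)"
      unfolding p_def using X[of n]
      by (intro finite_measure_finite_Union[symmetric]) (auto simp: disjoint_family_on_def)
    thus ?thesis by simp
  qed
  obtain q where q: "\<And>k. (\<lambda>n. p n k) \<longlonglongrightarrow> q k" "\<And>k. 0 \<le> q k" "q sums 1"
    "\<And>x. x \<in> {0<..<1} \<Longrightarrow> (\<lambda>k. q k * x ^ k) sums F x"
  proof (rule pgf_coefficients_converge[of p "\<lambda>n x. expectation (\<lambda>\<omega>. x ^ X n \<omega>)" F])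
    show "(\<lambda>k. p n k * x ^ k) sums expectation (\<lambda>\<omega>. x ^ X n \<omega>)" if "x \<in> {0<..<1}" for n x
      unfolding p_def using that by (intro pgf_sums X) auto
  qed (use le1 lim F1 in \<open>auto simp: p_def\<close>)
  obtain Y where Y: "\<And>k. pmf Y k = q k" using pmf_of_nat_weights[OF q(2,3)] by blast
  \<comment> \<open>The identity is viewed as a random variable on \<open>Y\<close>, so that the
    lemmas about random variables apply to the limit law as well.\<close>
  have Yk: "measure (measure_pmf Y) ((\<lambda>k. k) -` {k} \<inter> space (measure_pmf Y)) = q k" for k
    using Y[of k] by (simp add: measure_pmf_single vimage_def)
  have "measure_pmf.expectation Y (\<lambda>k. x ^ k) = F x" if "x \<in> {0<..<1}" for x
  proof -
    have "(\<lambda>k. q k * x ^ k) sums measure_pmf.expectation Y (\<lambda>k. x ^ k)"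
      using measure_pmf.pgf_sums[of "\<lambda>k. k" Y x] that unfolding Yk by simp
    thus ?thesis using q(4)[OF that] by (rule sums_unique2)
  qed
  moreover have "weak_conv_m (\<lambda>n. distr M borel (\<lambda>\<omega>. real (X n \<omega>))) (distr (measure_pmf Y) borel real)"
    unfolding weak_conv_m_def weak_conv_def
  proof (intro allI impI)
    fix t
    have "cdf (distr (measure_pmf Y) borel real) t = (\<Sum>k | real k \<le> t. q k)"
      using measure_pmf.cdf_nat_valued[of "\<lambda>k. k" Y t] unfolding Yk by simp
    moreover have "(\<lambda>n. cdf (distr M borel (\<lambda>\<omega>. real (X n \<omega>))) t) \<longlonglongrightarrow> (\<Sum>k | real k \<le> t. q k)"
      unfolding cdf_nat_valued[OF X] p_def[symmetric] by (intro tendsto_sum q)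
    ultimately show "(\<lambda>n. cdf (distr M borel (\<lambda>\<omega>. real (X n \<omega>))) t)
        \<longlonglongrightarrow> cdf (distr (measure_pmf Y) borel real) t" by simp
  qed
  ultimately show ?thesis by blast
qed

section \<open>Verification of the analytic hypotheses for the process\<close>

theorem theorem4:
  fixes M :: "'a measure"
    and xi :: "nat \<Rightarrow> nat \<Rightarrow> 'a \<Rightarrow> nat"
    and eps :: "nat \<Rightarrow> 'a \<Rightarrow> nat"
    and lam :: "nat \<Rightarrow> real"
  assumes "prob_space M"
    and meas_xi: "\<And>n j. n \<ge> 1 \<Longrightarrow> j \<ge> 1 \<Longrightarrow> xi n j \<in> measurable M (count_space UNIV)"
    and meas_eps: "\<And>n. n \<ge> 1 \<Longrightarrow> eps n \<in> measurable M (count_space UNIV)"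
    and indep: "prob_space.indep_vars M (\<lambda>_. count_space UNIV)
          (\<lambda>i. case i of Inl (n, j) \<Rightarrow> xi n j | Inr n \<Rightarrow> eps n)
          ({(n, j). n \<ge> 1 \<and> j \<ge> 1} <+> {n. n \<ge> 1})"
    and ident: "\<And>n j. n \<ge> 1 \<Longrightarrow> j \<ge> 1 \<Longrightarrow>
          distr M (count_space UNIV) (xi n j) = distr M (count_space UNIV) (xi n 1)"
    and int_xi1: "\<And>n. n \<ge> 1 \<Longrightarrow> integrable M (\<lambda>\<omega>. falling_fact 1 (xi n 1 \<omega>))"
    and int_xi2: "\<And>n. n \<ge> 1 \<Longrightarrow> integrable M (\<lambda>\<omega>. falling_fact 2 (xi n 1 \<omega>))"
    and int_eps: "\<And>n k. n \<ge> 1 \<Longrightarrow> integrable M (\<lambda>\<omega>. falling_fact k (eps n \<omega>))"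
    and rho_lt1: "\<And>n. n \<ge> 1 \<Longrightarrow> fact_moment M (xi n 1) 1 < 1"
    and rho_lim: "(\<lambda>n. fact_moment M (xi n 1) 1) \<longlonglongrightarrow> 1"
    and rho_div: "\<not> summable (\<lambda>n. 1 - fact_moment M (xi (Suc n) 1) 1)"
    and G2: "(\<lambda>n. fact_moment M (xi n 1) 2 / (1 - fact_moment M (xi n 1) 1)) \<longlonglongrightarrow> 0"
    and lam_lim: "\<And>j. j \<ge> 1 \<Longrightarrow>
          (\<lambda>n. fact_moment M (eps n) j / (real j * (1 - fact_moment M (xi n 1) 1))) \<longlonglongrightarrow> lam j"
    and lam_growth: "limsup (\<lambda>n. ereal (root n (lam n / fact n))) \<le> 1"
  shows "\<exists>Y :: nat pmf.
           weak_conv_m (\<lambda>n. distr M borel (\<lambda>\<omega>. real (bpi xi eps n \<omega>)))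
                       (distr (measure_pmf Y) borel real)
         \<and> (\<forall>x \<in> {0<..<1::real}.
              measure_pmf.expectation Y (\<lambda>k. x ^ k)
                = exp (\<Sum>l. (x - 1) ^ Suc l / fact (Suc l) * lam (Suc l)))"
proof -
  interpret prob_space M by fact
  \<comment> \<open>Index \<open>n\<close> here and in \<open>b\<close>, \<open>h\<close>,
    \<open>g\<close> refers to generation \<open>Suc n\<close>, because the hypotheses concern
    generations from 1 on.\<close>
  define a where "a n = 1 - fact_moment M (xi (Suc n) 1) 1" for n
  define b where "b n j = fact_moment M (eps (Suc n)) j / fact j" for n j
  \<comment> \<open>The exponent starts at \<open>l = 1\<close>, and nothing is assumed about
    \<open>lam 0\<close>; setting the constant coefficient to 0 also gives
    \<open>\<Phi> 0 = 1\<close>.\<close>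
  define c where "c l = (if l = 0 then 0 else lam l / fact l)" for l :: nat
  define h where "h n y = expectation (\<lambda>\<omega>. (1 + y) ^ eps (Suc n) \<omega>)" for n and y :: real
  define g where "g n y = expectation (\<lambda>\<omega>. (1 + y) ^ xi (Suc n) 1 \<omega>) - 1" for n and y :: real
  define \<phi> where "\<phi> n y = expectation (\<lambda>\<omega>. (1 + y) ^ bpi xi eps n \<omega>)" for n and y :: real
  define Q where "Q y = (\<Sum>j. diffs c j * y ^ j)" for y
  define \<Phi> where "\<Phi> y = exp (\<Sum>l. c l * y ^ l)" for y

  have a_pos: "0 < a n" and a_le1: "a n \<le> 1" for n
    using rho_lt1[of "Suc n"] fact_moment_nonneg[of M "xi (Suc n) 1" 1] by (auto simp: a_def)
  have a_lim: "a \<longlonglongrightarrow> 0"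
    using tendsto_diff[OF tendsto_const[of 1] LIMSEQ_Suc[OF rho_lim]] by (simp add: a_def[abs_def])
  have a_div: "\<not> summable a" using rho_div by (simp add: a_def[abs_def])
  have b_lim: "(\<lambda>n. b n (Suc j) / a n) \<longlonglongrightarrow> diffs c j" for j
  proof -
    have "(\<lambda>n. fact_moment M (eps (Suc n)) (Suc j) / (real (Suc j) * a n) * (real (Suc j) / fact (Suc j)))
        \<longlonglongrightarrow> lam (Suc j) * (real (Suc j) / fact (Suc j))"
      unfolding a_def by (intro tendsto_mult tendsto_const LIMSEQ_Suc[OF lam_lim]) auto
    thus ?thesis by (simp add: b_def c_def diffs_def mult.commute del: fact_Suc of_nat_Suc)
  qed
  \<comment> \<open>The growth hypothesis bounds roots of \<open>lam n / fact n\<close>, whereas the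
    convergence radius is defined by roots of absolute values; nonnegativity identifies the
    two.\<close>
  have lam_nonneg: "0 \<le> lam j" if "j \<ge> 1" for j
    by (rule LIMSEQ_le_const[OF LIMSEQ_Suc[OF lam_lim[OF that]]])
       (use a_pos in \<open>auto simp: a_def less_imp_le intro!: divide_nonneg_nonneg mult_nonneg_nonneg fact_moment_nonneg\<close>)
  have conv: "conv_radius c \<ge> 1"
  proof -
    have "limsup (\<lambda>n. ereal (root n (norm (c n)))) = limsup (\<lambda>n. ereal (root n (lam n / fact n)))"
      by (intro Limsup_eq eventually_mono[OF eventually_ge_at_top[of 1]]) (simp add: c_def lam_nonneg)
    hence "limsup (\<lambda>n. ereal (root n (norm (c n)))) \<le> 1" using lam_growth by simp
    \<comment> \<open>Inversion of extended reals is antitone only on the nonnegative ones.\<close>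
    moreover have "0 \<le> limsup (\<lambda>n. ereal (root n (norm (c n))))"
      by (rule le_Limsup) (auto intro!: always_eventually real_root_ge_zero)
    ultimately have "inverse 1 \<le> inverse (limsup (\<lambda>n. ereal (root n (norm (c n)))))"
      by (intro ereal_inverse_antimono)
    thus ?thesis by (simp add: conv_radius_def one_ereal_def)
  qed

  have h_exp: "\<bar>h n y - 1 - (\<Sum>j<K. b n (Suc j) * y ^ Suc j)\<bar> \<le> b n (Suc K) * \<bar>y\<bar> ^ Suc K"
    if "y \<in> {-1..0}" for n y K
  proof -
    have "\<bar>h n y - (\<Sum>j<Suc K. b n j * y ^ j)\<bar> \<le> b n (Suc K) * \<bar>y\<bar> ^ Suc K"
      unfolding h_def b_def using that
      by (intro pgf_factorial_moment_expansion meas_eps int_eps) auto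
    moreover have "b n 0 = 1" by (simp add: b_def fact_moment_def falling_fact_def prob_space)
    ultimately show ?thesis by (simp add: sum.lessThan_Suc_shift algebra_simps del: sum.lessThan_Suc)
  qed
  have int_xi: "integrable M (\<lambda>\<omega>. falling_fact j (xi (Suc n) 1 \<omega>))" if "j \<le> 2" for j n
  proof -
    consider "j = 0" | "j = 1" | "j = 2" using \<open>j \<le> 2\<close> by linarith
    thus ?thesis using int_xi1[of "Suc n"] int_xi2[of "Suc n"]
      by cases (auto simp: falling_fact_eq[of 0])
  qed
  have g_abs: "\<bar>g n y\<bar> \<le> (1 - a n) * \<bar>y\<bar>" if "y \<in> {-1..0}" for n y
    using pgf_factorial_moment_expansion[OF meas_xi that, of "Suc n" 1 1] int_xi[of _ n]
    by (simp add: g_def a_def fact_moment_def[of _ _ 0] falling_fact_eq[of 0] prob_space)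
  have g_exp: "\<bar>g n y - (1 - a n) * y\<bar> \<le> fact_moment M (xi (Suc n) 1) 2 / 2 * y\<^sup>2" if "y \<in> {-1..0}" for n y
    using pgf_factorial_moment_expansion[OF meas_xi that, of "Suc n" 1 2] int_xi[of _ n]
    by (simp add: g_def a_def numeral_2_eq_2 fact_moment_def[of _ _ 0] falling_fact_eq[of 0] prob_space algebra_simps)
  have g_nonpos: "g n y \<le> 0" if "y \<in> {-1..0}" for n y
    using pgf_range(2)[OF meas_xi, of "Suc n" 1 "1 + y"] that by (simp add: g_def)
  have g_range: "g n y \<in> {-r..0}" if "y \<in> {-r..0}" "r < 1" for n y r
  proof -
    have y: "y \<in> {-1..0}" using that by auto
    have "(1 - a n) * \<bar>y\<bar> \<le> 1 * \<bar>y\<bar>" using a_pos[of n] by (intro mult_right_mono) auto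
    thus ?thesis using g_abs[OF y, of n] g_nonpos[OF y, of n] that by auto
  qed
  have bpi_meas: "bpi xi eps n \<in> measurable M (count_space UNIV)" for n
    by (intro measurable_bpi meas_xi meas_eps)
  have G2': "(\<lambda>n. fact_moment M (xi (Suc n) 1) 2 / 2 / a n) \<longlonglongrightarrow> 0"
    using tendsto_mult_right_zero[OF LIMSEQ_Suc[OF G2], of "1/2"] by (simp add: a_def mult.commute)

  have \<Phi>_deriv: "(\<Phi> has_real_derivative Q y * \<Phi> y) (at y)" and Q_cont: "isCont Q y"
    if "\<bar>y\<bar> < 1" for y
    using exp_power_series_derivative[OF conv that] by (simp_all add: \<Phi>_def[abs_def] Q_def[abs_def])
  have \<Phi>0: "\<Phi> 0 = 1" by (simp add: \<Phi>_def c_def)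

  have lim: "(\<lambda>n. \<phi> n y) \<longlonglongrightarrow> \<Phi> y" if "y \<in> {-1<..<0}" for y
  proof -
    \<comment> \<open>This interval contains \<open>y\<close> as its endpoint, and every
      \<open>g n\<close> maps it into itself.\<close>
    define r where "r = - y"
    have r: "0 \<le> r" "r < 1" and y: "y \<in> {-r..0}" using that by (auto simp: r_def)
    have sub: "z \<in> {-1..0}" "\<bar>z\<bar> < 1" if "z \<in> {-r..0}" for z using that r by auto
    have contQ: "continuous_on {-r..0} Q"
      by (intro continuous_at_imp_continuous_on ballI Q_cont sub)
    have cont\<Phi>: "continuous_on {-r..0} \<Phi>"
      by (intro continuous_at_imp_continuous_on ballI DERIV_isCont[OF \<Phi>_deriv] sub)
    have "bounded ((\<lambda>y. Q y * \<Phi> y) ` {-r..0})"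
      by (intro compact_imp_bounded compact_continuous_image continuous_intros contQ cont\<Phi>) auto
    then obtain B where B: "\<And>z. z \<in> {-r..0} \<Longrightarrow> norm (Q z * \<Phi> z) \<le> B"
      unfolding bounded_iff by blast
    have \<Phi>_lip: "\<bar>\<Phi> z - 1\<bar> \<le> B * \<bar>z\<bar>" if z: "z \<in> {-r..0}" for z
    proof -
      have "norm (\<Phi> z - \<Phi> 0) \<le> B * norm (z - 0)"
      proof (rule field_differentiable_bound[of "{-r..0}" \<Phi> "\<lambda>y. Q y * \<Phi> y"])
        show "(\<Phi> has_field_derivative Q u * \<Phi> u) (at u within {-r..0})" if "u \<in> {-r..0}" for u
          by (rule has_field_derivative_at_within[OF \<Phi>_deriv[OF sub(2)[OF that]]])
      next
        show "0 \<in> {-r..0}" using r by simp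
      qed (rule convex_real_interval B z, assumption?)+
      thus ?thesis by (simp add: \<Phi>0)
    qed
    have near: "\<forall>\<^sub>F n in sequentially. \<forall>y\<in>{-r..0}. \<bar>h n y * \<Phi> (g n y) - \<Phi> y\<bar> \<le> e * a n * \<bar>y\<bar>"
      if "e > 0" for e
    proof (rule near_fixed_point_estimate[OF r that _ contQ a_pos a_lim G2'])
      show "\<forall>\<^sub>F n in sequentially. \<forall>y\<in>{-r..0}. \<bar>h n y - 1 - a n * y * Q y\<bar> \<le> e * a n * \<bar>y\<bar>"
        if "e > 0" for e
        unfolding Q_def by (rule pgf_coefficient_expansion[OF r that a_pos conv b_lim h_exp])
      show "(\<Phi> has_real_derivative Q z * \<Phi> z) (at z)" if "z \<in> {-r..0}" for z
        by (rule \<Phi>_deriv[OF sub(2)[OF that]])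
      show "g n z \<in> {-r..0}" if "z \<in> {-r..0}" for n z
        by (rule g_range[OF that r(2)])
      show "\<bar>g n z - (1 - a n) * z\<bar> \<le> fact_moment M (xi (Suc n) 1) 2 / 2 * z\<^sup>2" if "z \<in> {-r..0}" for n z
        by (rule g_exp[OF sub(1)[OF that]])
    qed
    show ?thesis
    proof (rule contracting_recursion_tendsto[where a = a and g = g and h = h and D = "\<lambda>n. b n 1",
          OF less_imp_le[OF a_pos] a_le1 a_div _ _ \<Phi>_lip _ _ _ _ near y])
      fix n and z :: real assume z: "z \<in> {-r..0}"
      have z1: "0 \<le> 1 + z" "1 + z \<le> 1" using z r by auto
      show "\<phi> (Suc n) z = h n z * \<phi> n (g n z)"
        using bpi_pgf_recursion[OF meas_xi meas_eps indep ident z1, of n]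
        by (simp add: \<phi>_def h_def g_def)
      show "0 \<le> h n z \<and> h n z \<le> 1"
        unfolding h_def using pgf_range[OF meas_eps z1, of "Suc n"] by simp
      show "\<bar>h n z - 1\<bar> \<le> b n 1 * \<bar>z\<bar>" using h_exp[OF sub(1)[OF z], of n 0] by simp
      show "g n z \<in> {-r..0}" by (rule g_range[OF z r(2)])
      show "\<bar>g n z\<bar> \<le> (1 - a n) * \<bar>z\<bar>" by (rule g_abs[OF sub(1)[OF z]])
    next
      show "\<phi> 0 z = 1" for z by (simp add: \<phi>_def prob_space)
    qed
  qed

  define F where "F x = \<Phi> (x - 1)" for x
  have F_eq: "F x = exp (\<Sum>l. (x - 1) ^ Suc l / fact (Suc l) * lam (Suc l))" if "x \<in> {0<..<1}" for x
  proof -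
    have "ereal (norm (x - 1)) < 1" using that by simp
    hence "summable (\<lambda>l. c l * (x - 1) ^ l)"
      by (intro summable_in_conv_radius less_le_trans[OF _ conv])
    from suminf_split_head[OF this] have "(\<Sum>l. c l * (x - 1) ^ l) = (\<Sum>l. c (Suc l) * (x - 1) ^ Suc l)"
      by (simp add: c_def)
    thus ?thesis by (simp add: F_def \<Phi>_def c_def mult_ac)
  qed
  have "\<exists>Y :: nat pmf. weak_conv_m (\<lambda>n. distr M borel (\<lambda>\<omega>. real (bpi xi eps n \<omega>)))
                       (distr (measure_pmf Y) borel real)
         \<and> (\<forall>x \<in> {0<..<1::real}. measure_pmf.expectation Y (\<lambda>k. x ^ k) = F x)"
  proof (rule weak_conv_of_pgf_tendsto[OF bpi_meas])
    show "(\<lambda>n. expectation (\<lambda>\<omega>. x ^ bpi xi eps n \<omega>)) \<longlonglongrightarrow> F x" if "x \<in> {0<..<1}" for x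
      using lim[of "x - 1"] that by (simp add: \<phi>_def F_def)
    \<comment> \<open>The point \<open>x = 1\<close> corresponds to \<open>y = 0\<close>, an
      interior point of the domain where \<open>\<Phi>\<close> is differentiable; this supplies the
      condition that no mass is lost.\<close>
    have "isCont \<Phi> (1 - 1)" using DERIV_isCont[OF \<Phi>_deriv[of 0]] by simp
    hence "isCont F 1" unfolding F_def by (intro continuous_at_compose[unfolded o_def, of 1 "\<lambda>x. x - 1" \<Phi>]) auto
    hence "(F \<longlongrightarrow> F 1) (at 1)" by (simp add: isCont_def)
    thus "(F \<longlongrightarrow> 1) (at_left 1)"
      unfolding F_def[of 1] by (simp add: \<Phi>0 filterlim_at_split)
  qed
  thus ?thesis using F_eq by auto
qed

end
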